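(* Let $E$ be a real linear space, $\psi:E\to\mathbb{R}$ a seminorm, $K, A\subseteq E$ nontrivial, convex cones with normlike-bases $B_K$ and $B_A$ (with respect to $\psi$), and let $K$ be solid. Define $S_{-K}:=\mathrm{conv}(-B_K)$ and $S_A^0:=\mathrm{conv}(B_A\cup\{0\})$. Suppose that $S_{-K}$ is solid. Then the following assertions are equivalent: $1^\circ$ $S_A^0\cap\mathrm{cor}\,S_{-K}=\emptyset$. $2^\circ$ $A\cap\mathrm{cor}(-K)=\emptyset$. $3^\circ$ There exists $x'\in K^+\setminus\{0\}$ such that $x'(a)\geq 0>x'(k)$ for all $a\in A$ and $k\in\mathrm{cor}(-K)$. $4^\circ$ There exists $(x',\alpha)\in K^{a\circ}$ such that $x'(a)+\alpha\psi(a)\geq 0>x'(k)+\alpha\psi(k)$ for all $a\in A$ and $k\in\mathrm{cor}(-K)$.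
   Context: $E\neq\{0\}$ is a real linear space with algebraic dual $E'$; $\mathbb{R}_+=[0,\infty)$. A set $K\subseteq E$ is a cone if $0\in K=\mathbb{R}_+\cdot K$; it is nontrivial if $\{0\}\neq K\neq E$; $\ell(K):=K\cap(-K)$ (same notation for cones in $E'$). A seminorm is a sublinear symmetric function $\psi:E\to\mathbb{R}$. A nontrivial cone $K$ has a normlike-base (w.r.t. $\psi$) if $\psi(x)>0$ for all $x\in K\setminus\{0\}$; the normlike-base is then $B_K:=\{x\in K\mid \psi(x)=1\}$. All normlike-bases are taken with respect to the same fixed seminorm $\psi$. For $\Omega\subseteq E$: $\mathrm{cor}\,\Omega:=\{x\in\Omega\mid \forall v\in E\ \exists\varepsilon>0:\ x+[0,\varepsilon]\cdot v\subseteq\Omega\}$ and $\mathrm{icor}\,\Omega:=\{x\in\Omega\mid \forall v\in \mathrm{aff}(\Omega-\Omega)\ \exists\varepsilon>0:\ x+[0,\varepsilon]\cdot v\subseteq\Omega\}$, where $\mathrm{aff}$ is the affine hull; $\Omega$ is solid if $\mathrm{cor}\,\Omega\neq\emptyset$. $\mathrm{conv}$ denotes the convex hull. $K^+:=\{y'\in E'\mid \forall k\in K:\ y'(k)\geq 0\}$ and $K^{a\circ}:=\{(x',\alpha)\in (K^+\setminus\ell(K^+))\times\mathbb{R}_+\mid \forall y\in\mathrm{icor}\,K:\ x'(y)-\alpha\psi(y)>0\}$. *)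

theory Defs
  imports "HOL-Analysis.Analysis"
begin

text \<open>
  The ambient space is a bare real vector space: type class \<^class>\<open>real_vector\<close>, no topology.
  The library predicate \<^const>\<open>cone\<close> says that a set is closed under nonnegative scaling, and it
  holds of the empty set; \<open>0 \<in> K\<close> is therefore required separately.
\<close>

definition cone0 :: "'a::real_vector set \<Rightarrow> bool" where
  "cone0 K \<longleftrightarrow> 0 \<in> K \<and> cone K"

lemma cone0_iff: "cone0 K \<longleftrightarrow> 0 \<in> K \<and> K = {t *\<^sub>R x | t x. 0 \<le> t \<and> x \<in> K}"
proof
  assume "cone0 K"
  then have K: "0 \<in> K" "\<And>t x. x \<in> K \<Longrightarrow> 0 \<le> t \<Longrightarrow> t *\<^sub>R x \<in> K"
    by (auto simp: cone0_def cone_def)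
  have "\<exists>t y. x = t *\<^sub>R y \<and> 0 \<le> t \<and> y \<in> K" if "x \<in> K" for x
    using that by (intro exI[of _ 1] exI[of _ x]) simp
  with K show "0 \<in> K \<and> K = {t *\<^sub>R x | t x. 0 \<le> t \<and> x \<in> K}"
    by blast
next
  assume "0 \<in> K \<and> K = {t *\<^sub>R x | t x. 0 \<le> t \<and> x \<in> K}"
  then show "cone0 K"
    unfolding cone0_def cone_def by blast
qed

definition nontrivial_cone :: "'a::real_vector set \<Rightarrow> bool" where
  "nontrivial_cone K \<longleftrightarrow> cone0 K \<and> K \<noteq> {0} \<and> K \<noteq> UNIV"

text \<open>
  Polymorphic, so as to apply to subsets of the space as well as to sets of functionals
  (where negation is pointwise).
\<close>

definition lineality :: "'b::uminus set \<Rightarrow> 'b set" where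
  "lineality K = K \<inter> uminus ` K"

definition seminorm :: "('a::real_vector \<Rightarrow> real) \<Rightarrow> bool" where
  "seminorm \<psi> \<longleftrightarrow>
     (\<forall>x y. \<psi> (x + y) \<le> \<psi> x + \<psi> y) \<and>
     (\<forall>t x. 0 \<le> t \<longrightarrow> \<psi> (t *\<^sub>R x) = t * \<psi> x) \<and>
     (\<forall>x. \<psi> (- x) = \<psi> x)"

definition has_normlike_base :: "('a::real_vector \<Rightarrow> real) \<Rightarrow> 'a set \<Rightarrow> bool" where
  "has_normlike_base \<psi> K \<longleftrightarrow> (\<forall>x \<in> K - {0}. \<psi> x > 0)"

definition normlike_base :: "('a::real_vector \<Rightarrow> real) \<Rightarrow> 'a set \<Rightarrow> 'a set" where
  "normlike_base \<psi> K = {x \<in> K. \<psi> x = 1}"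

definition cor :: "'a::real_vector set \<Rightarrow> 'a set" where
  "cor \<Omega> = {x \<in> \<Omega>. \<forall>v. \<exists>\<epsilon>>0. \<forall>t\<in>{0..\<epsilon>}. x + t *\<^sub>R v \<in> \<Omega>}"

definition icor :: "'a::real_vector set \<Rightarrow> 'a set" where
  "icor \<Omega> = {x \<in> \<Omega>. \<forall>v \<in> affine hull {y - z | y z. y \<in> \<Omega> \<and> z \<in> \<Omega>}.
                 \<exists>\<epsilon>>0. \<forall>t\<in>{0..\<epsilon>}. x + t *\<^sub>R v \<in> \<Omega>}"

definition solid :: "'a::real_vector set \<Rightarrow> bool" where
  "solid \<Omega> \<longleftrightarrow> cor \<Omega> \<noteq> {}"

definition dual_cone :: "'a::real_vector set \<Rightarrow> ('a \<Rightarrow> real) set" where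
  "dual_cone K = {y'. linear y' \<and> (\<forall>k\<in>K. y' k \<ge> 0)}"

definition aug_dual_cone ::
    "('a::real_vector \<Rightarrow> real) \<Rightarrow> 'a set \<Rightarrow> (('a \<Rightarrow> real) \<times> real) set" where
  "aug_dual_cone \<psi> K =
     {(x', \<alpha>). x' \<in> dual_cone K - lineality (dual_cone K) \<and> 0 \<le> \<alpha> \<and>
              (\<forall>y \<in> icor K. x' y - \<alpha> * \<psi> y > 0)}"

definition S_minus :: "('a::real_vector \<Rightarrow> real) \<Rightarrow> 'a set \<Rightarrow> 'a set" where
  "S_minus \<psi> K = convex hull (uminus ` normlike_base \<psi> K)"

definition S_zero :: "('a::real_vector \<Rightarrow> real) \<Rightarrow> 'a set \<Rightarrow> 'a set" where
  "S_zero \<psi> A = convex hull (normlike_base \<psi> A \<union> {0})"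

end

theory Submission
  imports Defs
begin

text \<open>
  The implication from the second to the third assertion is an algebraic Hahn--Banach separation.
  For \<open>e \<in> cor K\<close> the convex cone \<open>A + K\<close> avoids \<open>- e\<close>; by Zorn's lemma it
  lies in a maximal convex cone \<open>C\<close> avoiding \<open>- e\<close>, and maximality forces
  \<open>x \<in> C\<close> or \<open>- x \<in> C\<close> for every \<open>x\<close>. As \<open>e\<close> is an order unit
  for \<open>C\<close>, the map sending \<open>x\<close> to the supremum of all \<open>t\<close> with
  \<open>x - t e \<in> C\<close> is then a linear functional with the required signs. It satisfies the fourth
  assertion with \<open>\<alpha> = 0\<close>.

  For the equivalence of the first two, let \<open>b\<close> be in \<open>B\<^sub>A\<close> and in the core of
  \<open>- K\<close>, and let \<open>s\<close> be in the core of \<open>conv (- B\<^sub>K)\<close>. Then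
  \<open>b = \<epsilon> s + \<mu> d\<close> with \<open>\<epsilon> > 0\<close>, \<open>\<mu> \<ge> 0\<close> and
  \<open>d \<in> - B\<^sub>K\<close>, so \<open>b / (\<epsilon> + \<mu>)\<close> is in the core of
  \<open>conv (- B\<^sub>K)\<close>; it is in \<open>conv (B\<^sub>A \<union> {0})\<close> because
  \<open>1 = \<psi> b \<le> \<epsilon> + \<mu>\<close>.
\<close>

section \<open>Separation by maximal convex cones\<close>

text \<open>If \<open>x\<close> lies outside a maximal \<open>C\<close>, then \<open>C\<close>
  enlarged by the ray through \<open>x\<close> contains \<open>- e\<close>. Having this for both
  \<open>x\<close> and \<open>- x\<close>, a positive combination eliminates \<open>x\<close> and
  puts \<open>- e\<close> into \<open>C\<close>, a contradiction.\<close>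

lemma maximal_convex_cone_total:
  fixes C\<^sub>0 :: "'a::real_vector set"
  assumes "convex_cone C\<^sub>0" and "- e \<notin> C\<^sub>0"
  obtains C where "C\<^sub>0 \<subseteq> C" "convex_cone C" "- e \<notin> C" "\<And>x. x \<in> C \<or> - x \<in> C"
proof -
  define \<A> where "\<A> = {C. C\<^sub>0 \<subseteq> C \<and> convex_cone C \<and> - e \<notin> C}"
  have "\<Union>\<C> \<in> \<A>" if ne: "\<C> \<noteq> {}" and ch: "subset.chain \<A> \<C>" for \<C>
  proof -
    have mem: "C\<^sub>0 \<subseteq> C \<and> convex_cone C \<and> - e \<notin> C" if "C \<in> \<C>" for C
      using ch that unfolding subset.chain_def \<A>_def by auto
    have "x + y \<in> \<Union>\<C>" if xy: "x \<in> \<Union>\<C>" "y \<in> \<Union>\<C>" for x y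
    proof -
      obtain X Y where XY: "X \<in> \<C>" "x \<in> X" "Y \<in> \<C>" "y \<in> Y"
        using xy by blast
      then have "X \<subseteq> Y \<or> Y \<subseteq> X"
        using ch unfolding subset_chain_def by blast
      then obtain Z where "Z \<in> \<C>" "x \<in> Z" "y \<in> Z"
        using XY by blast
      then show ?thesis
        using mem convex_cone_add[of Z x y] by blast
    qed
    moreover have "c *\<^sub>R x \<in> \<Union>\<C>" if "x \<in> \<Union>\<C>" "0 \<le> c" for x c
      using that mem convex_cone_scaleR by blast
    moreover have "0 \<in> \<Union>\<C>"
      using ne mem convex_cone_contains_0 by blast
    ultimately have "convex_cone (\<Union>\<C>)"
      unfolding convex_cone_iff by blast
    then show ?thesis
      using ne mem unfolding \<A>_def by blast
  qed
  moreover have "\<A> \<noteq> {}"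
    using assms unfolding \<A>_def by auto
  ultimately obtain C where "C \<in> \<A>" and max: "\<And>D. D \<in> \<A> \<Longrightarrow> C \<subseteq> D \<Longrightarrow> D = C"
    using subset_Zorn_nonempty[of \<A>] by blast
  then have C: "C\<^sub>0 \<subseteq> C" "convex_cone C" "- e \<notin> C"
    unfolding \<A>_def by auto
  have extend: "\<exists>c t. c \<in> C \<and> 0 < t \<and> - e = c + t *\<^sub>R x" if "x \<notin> C" for x
  proof -
    \<comment> \<open>\<open>D\<close> is \<open>C\<close> plus the ray spanned by \<open>x\<close>,
      a convex cone strictly larger than \<open>C\<close>. By maximality it is outside the family,
      and the only way it can fail is by containing \<open>- e\<close>.\<close>
    define R where "R = {t *\<^sub>R x | t. 0 \<le> t}"
    define D where "D = (\<Union>c\<in>C. \<Union>y\<in>R. {c + y})"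
    have "convex_cone R"
    proof -
      have "t *\<^sub>R x + s *\<^sub>R x \<in> R" if "0 \<le> t" "0 \<le> s" for t s
        unfolding R_def using that
        by (intro CollectI exI[of _ "t + s"]) (simp add: scaleR_add_left)
      moreover have "c *\<^sub>R t *\<^sub>R x \<in> R" if "0 \<le> t" "0 \<le> c" for t c
        unfolding R_def using that by (intro CollectI exI[of _ "c * t"]) simp
      moreover have "0 \<in> R"
        unfolding R_def by (intro CollectI exI[of _ 0]) simp
      ultimately show ?thesis
        unfolding convex_cone_iff by (auto simp: R_def)
    qed
    then have "convex_cone D"
      unfolding D_def using C(2) by (intro convex_cone_sums)
    moreover have "C \<subseteq> D"
    proof
      fix c assume "c \<in> C"
      moreover have "0 \<in> R"
        by (rule convex_cone_contains_0) fact
      ultimately show "c \<in> D"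
        unfolding D_def by (intro UN_I[of c] UN_I[of 0]) auto
    qed
    moreover have "x \<in> D"
    proof -
      have "x \<in> R"
        unfolding R_def by (intro CollectI exI[of _ 1]) simp
      then show ?thesis
        unfolding D_def using convex_cone_contains_0[OF C(2)]
        by (intro UN_I[of 0] UN_I[of x]) auto
    qed
    ultimately have "- e \<in> D"
      using max[of D] that C(1) unfolding \<A>_def by blast
    then obtain c t where ct: "c \<in> C" "0 \<le> t" "- e = c + t *\<^sub>R x"
      unfolding D_def R_def by blast
    have "t \<noteq> 0"
    proof
      assume "t = 0"
      with ct(3) have "- e = c"
        by simp
      with ct(1) C(3) show False
        by blast
    qed
    with ct show ?thesis
      by (intro exI[of _ c] exI[of _ t]) simp
  qed
  have "x \<in> C \<or> - x \<in> C" for x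
  proof (rule ccontr)
    assume "\<not> (x \<in> C \<or> - x \<in> C)"
    then have x: "x \<notin> C" "- x \<notin> C"
      by blast+
    obtain c t where c: "c \<in> C" "0 < t" and e: "- e = c + t *\<^sub>R x"
      using extend[OF x(1)] by blast
    obtain c' t' where c': "c' \<in> C" "0 < t'" and e': "- e = c' + t' *\<^sub>R (- x)"
      using extend[OF x(2)] by blast
    \<comment> \<open>The weights \<open>t'\<close> and \<open>t\<close> are chosen so that the
      multiples of \<open>x\<close> cancel.\<close>
    have "(t + t') *\<^sub>R (- e) = t' *\<^sub>R (- e) + t *\<^sub>R (- e)"
      by (simp add: algebra_simps)
    also have "\<dots> = t' *\<^sub>R (c + t *\<^sub>R x) + t *\<^sub>R (c' + t' *\<^sub>R (- x))"
      by (simp only: e[symmetric] e'[symmetric])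
    also have "\<dots> = t' *\<^sub>R c + t *\<^sub>R c'"
      by (simp add: algebra_simps)
    finally have "(t + t') *\<^sub>R (- e) \<in> C"
      using c c' C(2) by (simp add: convex_cone_add convex_cone_scaleR)
    moreover have pos: "0 < t + t'"
      using c(2) c'(2) by simp
    ultimately have "inverse (t + t') *\<^sub>R (t + t') *\<^sub>R (- e) \<in> C"
      by - (rule convex_cone_scaleR[OF C(2)], simp_all)
    moreover have "inverse (t + t') *\<^sub>R (t + t') *\<^sub>R (- e) = - e"
      using pos by (metis less_irrefl left_inverse scaleR_one scaleR_scaleR)
    ultimately show False
      using C(3) by simp
  qed
  with that C show ?thesis
    by blast
qed

text \<open>By totality, each \<open>x\<close> splits the real line into a Dedekind cut according to
  whether \<open>x - s *\<^sub>R e\<close> or its negative lies in \<open>C\<close>. The cut point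
  is the value at \<open>x\<close>; linearity holds because cuts can be added and multiplied by
  positive factors.\<close>

lemma order_unit_functional:
  fixes C :: "'a::real_vector set"
  assumes C: "convex_cone C" and ne: "- e \<notin> C" and total: "\<And>x. x \<in> C \<or> - x \<in> C"
    and unit: "\<And>x. \<exists>t. x + t *\<^sub>R e \<in> C"
  obtains f :: "'a \<Rightarrow> real" where "linear f" "f e = 1" "\<And>x. x \<in> C \<Longrightarrow> 0 \<le> f x"
proof -
  have e: "e \<in> C"
    using ne total by blast
  have scale_e: "r *\<^sub>R e \<in> C \<longleftrightarrow> 0 \<le> r" for r
  proof
    assume r: "r *\<^sub>R e \<in> C"
    show "0 \<le> r"
    proof (rule ccontr)
      assume "\<not> 0 \<le> r"
      then have "inverse (- r) *\<^sub>R r *\<^sub>R e \<in> C"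
        by - (rule convex_cone_scaleR[OF C _ r], simp)
      with \<open>\<not> 0 \<le> r\<close> ne show False
        by simp
    qed
  qed (use e C in \<open>simp add: convex_cone_scaleR\<close>)
  \<comment> \<open>\<open>P x t\<close> says that \<open>t\<close> is the cut point of
    \<open>x\<close>. The inequalities are strict because \<open>C\<close> need not contain
    \<open>x - t *\<^sub>R e\<close> at the cut itself.\<close>
  define P where "P x t \<longleftrightarrow>
    (\<forall>s. (s < t \<longrightarrow> x - s *\<^sub>R e \<in> C) \<and> (t < s \<longrightarrow> s *\<^sub>R e - x \<in> C))" for x t
  have le: "t \<le> t'" if "P x t" "P x t'" for x t t'
  proof (rule ccontr)
    assume "\<not> t \<le> t'"
    \<comment> \<open>Two distinct levels in the gap between \<open>t'\<close> and \<open>t\<close>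
      make the sum below a strictly negative multiple of \<open>e\<close>, which
      \<open>scale_e\<close> excludes.\<close>
    then obtain s s' where s: "t' < s" "s < s'" "s' < t"
      by (meson dense not_le)
    then have "(s *\<^sub>R e - x) + (x - s' *\<^sub>R e) \<in> C"
      using that C unfolding P_def by - (rule convex_cone_add, auto)
    then have "(s - s') *\<^sub>R e \<in> C"
      by (simp add: algebra_simps)
    with s show False
      by (simp add: scale_e)
  qed
  have ex: "\<exists>t. P x t" for x
  proof -
    \<comment> \<open>The supremum of \<open>T\<close> is the cut point; the order unit property at
      \<open>x\<close> makes \<open>T\<close> nonempty, and at \<open>- x\<close> it bounds
      \<open>T\<close> above.\<close>
    define T where "T = {t. x - t *\<^sub>R e \<in> C}"
    obtain t\<^sub>0 t\<^sub>1 where t: "x + t\<^sub>0 *\<^sub>R e \<in> C" "- x + t\<^sub>1 *\<^sub>R e \<in> C"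
      using unit by blast
    have "x - (- t\<^sub>0) *\<^sub>R e \<in> C"
      using t by simp
    then have nonempty: "T \<noteq> {}"
      unfolding T_def by blast
    have "t \<le> t\<^sub>1" if "t \<in> T" for t
    proof -
      have "(x - t *\<^sub>R e) + (- x + t\<^sub>1 *\<^sub>R e) \<in> C"
        using that t C unfolding T_def by - (rule convex_cone_add, auto)
      then have "(t\<^sub>1 - t) *\<^sub>R e \<in> C"
        by (simp add: algebra_simps)
      then show ?thesis
        by (simp add: scale_e)
    qed
    then have bdd: "bdd_above T"
      by (meson bdd_aboveI)
    have "x - s *\<^sub>R e \<in> C" if s: "s < Sup T" for s
    proof -
      obtain t where "t \<in> T" "s < t"
        using s nonempty bdd by (auto simp: less_cSup_iff)
      then have "(x - t *\<^sub>R e) + (t - s) *\<^sub>R e \<in> C"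
        using C unfolding T_def by - (rule convex_cone_add, auto simp: scale_e)
      then show ?thesis
        by (simp add: algebra_simps)
    qed
    moreover have "s *\<^sub>R e - x \<in> C" if "Sup T < s" for s
    proof -
      have "s \<notin> T"
        using that bdd cSup_upper by fastforce
      then show ?thesis
        using total[of "x - s *\<^sub>R e"] unfolding T_def by simp
    qed
    ultimately show ?thesis
      unfolding P_def by blast
  qed
  define f where "f x = (THE t. P x t)" for x
  have "\<exists>!t. P x t" for x
    using ex[of x] le[of x] by (blast intro: order_antisym)
  then have f: "P x (f x)" for x
    unfolding f_def by (rule theI')
  have eq: "f x = t" if "P x t" for x t
    using le f that by (metis order_antisym)
  have add: "f (x + y) = f x + f y" for x y
  proof (rule eq)
    have "x + y - s *\<^sub>R e \<in> C" if "s < f x + f y" for s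
    proof -
      \<comment> \<open>Each summand receives half of the slack, so both levels stay strictly below
        their cut points and still add up to \<open>s\<close>.\<close>
      define d where "d = (f x + f y - s) / 2"
      have "(x - (f x - d) *\<^sub>R e) + (y - (f y - d) *\<^sub>R e) \<in> C"
        using f C that unfolding P_def d_def by - (rule convex_cone_add, auto)
      moreover have "(f x - d) + (f y - d) = s"
        by (simp add: d_def field_simps)
      ultimately show ?thesis
        by (metis add_diff_add scaleR_add_left)
    qed
    moreover have "s *\<^sub>R e - (x + y) \<in> C" if "f x + f y < s" for s
    proof -
      define d where "d = (s - f x - f y) / 2"
      have "((f x + d) *\<^sub>R e - x) + ((f y + d) *\<^sub>R e - y) \<in> C"
        using f C that unfolding P_def d_def by - (rule convex_cone_add, auto)
      moreover have "(f x + d) + (f y + d) = s"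
        by (simp add: d_def field_simps)
      ultimately show ?thesis
        by (metis add_diff_add scaleR_add_left)
    qed
    ultimately show "P (x + y) (f x + f y)"
      unfolding P_def by blast
  qed
  have scale_pos: "f (c *\<^sub>R x) = c * f x" if "0 < c" for c x
  proof (rule eq)
    have "c *\<^sub>R x - s *\<^sub>R e \<in> C" if "s < c * f x" for s
    proof -
      have "s / c < f x"
        using that \<open>0 < c\<close> by (simp add: field_simps)
      then have "c *\<^sub>R (x - (s / c) *\<^sub>R e) \<in> C"
        using f C \<open>0 < c\<close> unfolding P_def by - (rule convex_cone_scaleR, auto)
      then show ?thesis
        using \<open>0 < c\<close> by (simp add: scaleR_diff_right)
    qed
    moreover have "s *\<^sub>R e - c *\<^sub>R x \<in> C" if "c * f x < s" for s
    proof -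
      have "f x < s / c"
        using that \<open>0 < c\<close> by (simp add: field_simps)
      then have "c *\<^sub>R ((s / c) *\<^sub>R e - x) \<in> C"
        using f C \<open>0 < c\<close> unfolding P_def by - (rule convex_cone_scaleR, auto)
      then show ?thesis
        using \<open>0 < c\<close> by (simp add: scaleR_diff_right)
    qed
    ultimately show "P (c *\<^sub>R x) (c * f x)"
      unfolding P_def by blast
  qed
  have zero: "f 0 = 0"
    using add[of 0 0] by simp
  have minus: "f (- x) = - f x" for x
    using add[of x "- x"] zero by simp
  \<comment> \<open>A negative factor reverses the cut, so it is reduced to a positive one by
    additivity.\<close>
  have "f (c *\<^sub>R x) = c *\<^sub>R f x" for c x
    using scale_pos[of c x] scale_pos[of "- c" x] minus[of "c *\<^sub>R x"] zero
    by (cases c "0::real" rule: linorder_cases) auto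
  then have "linear f"
    using add by (intro linearI) auto
  moreover have "f e = 1"
  proof (rule eq)
    have "e - s *\<^sub>R e \<in> C" if "s < 1" for s
      using that scale_e[of "1 - s"] by (simp add: scaleR_diff_left)
    moreover have "s *\<^sub>R e - e \<in> C" if "1 < s" for s
      using that scale_e[of "s - 1"] by (simp add: scaleR_diff_left)
    ultimately show "P e 1"
      unfolding P_def by blast
  qed
  moreover have "0 \<le> f x" if "x \<in> C" for x
  proof (rule ccontr)
    assume "\<not> 0 \<le> f x"
    \<comment> \<open>The level \<open>f x / 2\<close> lies strictly between \<open>f x\<close> and
      0: above the cut point of \<open>x\<close>, yet still a negative multiple of \<open>e\<close>
      once \<open>x\<close> is added back.\<close>
    then have "(f x / 2) *\<^sub>R e - x \<in> C"
      using f[of x] unfolding P_def by auto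
    then have "(f x / 2) *\<^sub>R e - x + x \<in> C"
      using that C by (intro convex_cone_add)
    with \<open>\<not> 0 \<le> f x\<close> show False
      by (simp add: scale_e)
  qed
  ultimately show ?thesis
    using that by blast
qed

section \<open>Algebraic interiors of convex cones\<close>

lemma corD: "x \<in> cor \<Omega> \<Longrightarrow> \<exists>\<epsilon>>0. x + \<epsilon> *\<^sub>R v \<in> \<Omega>"
  unfolding cor_def by fastforce

lemma cor_subset: "cor \<Omega> \<subseteq> \<Omega>"
  unfolding cor_def by blast

lemma cor_mono:
  assumes "S \<subseteq> T"
  shows "cor S \<subseteq> cor T"
  using assms unfolding cor_def by (fastforce dest: subsetD)

lemma cor_uminus: "cor (uminus ` S) = uminus ` cor (S::'a::real_vector set)"
proof -
  have *: "- x \<in> cor (uminus ` S)" if x: "x \<in> cor S" for x :: 'a and S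
  proof -
    have "\<exists>\<epsilon>>0. \<forall>t\<in>{0..\<epsilon>}. - x + t *\<^sub>R v \<in> uminus ` S" for v
    proof -
      obtain \<epsilon> where "\<epsilon> > 0" "\<forall>t\<in>{0..\<epsilon>}. x + t *\<^sub>R (- v) \<in> S"
        using x unfolding cor_def by blast
      then show ?thesis
        by (intro exI[of _ \<epsilon>]) (force intro: image_eqI[of _ _ "x + t *\<^sub>R (- v)" for t])
    qed
    then show ?thesis
      using x unfolding cor_def by blast
  qed
  have "x \<in> uminus ` cor S" if "x \<in> cor (uminus ` S)" for x
    using *[OF that] by (force simp: image_image)
  with * show ?thesis
    by blast
qed

text \<open>Scaling by \<open>u\<close> and translating by \<open>v *\<^sub>R d\<close> carries a
  segment from \<open>s\<close> in direction \<open>w / u\<close> to one from the combination in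
  direction \<open>w\<close>; convexity keeps it in \<open>S\<close>.\<close>

lemma cor_convex_combination:
  fixes S :: "'a::real_vector set"
  assumes "convex S" "s \<in> cor S" "d \<in> S" "0 < u" "0 \<le> v" "u + v = 1"
  shows "u *\<^sub>R s + v *\<^sub>R d \<in> cor S"
proof -
  have "\<exists>\<epsilon>>0. \<forall>t\<in>{0..\<epsilon>}. u *\<^sub>R s + v *\<^sub>R d + t *\<^sub>R w \<in> S" for w
  proof -
    obtain \<epsilon> where \<epsilon>: "\<epsilon> > 0" "\<forall>t\<in>{0..\<epsilon>}. s + t *\<^sub>R ((1 / u) *\<^sub>R w) \<in> S"
      using assms(2) unfolding cor_def by blast
    have "u *\<^sub>R s + v *\<^sub>R d + t *\<^sub>R w \<in> S" if "t \<in> {0..\<epsilon>}" for t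
    proof -
      have "u *\<^sub>R (s + t *\<^sub>R ((1 / u) *\<^sub>R w)) + v *\<^sub>R d \<in> S"
        using that \<epsilon> assms by (intro convexD) auto
      then show ?thesis
        using assms(4) by (simp add: algebra_simps)
    qed
    with \<epsilon>(1) show ?thesis
      by blast
  qed
  moreover have "u *\<^sub>R s + v *\<^sub>R d \<in> S"
    using assms cor_subset by (intro convexD) auto
  ultimately show ?thesis
    unfolding cor_def by blast
qed

lemma convex_cone_nontrivial_cone:
  assumes "nontrivial_cone K" "convex K"
  shows "convex_cone K"
  using assms unfolding nontrivial_cone_def cone0_def convex_cone_def conic_def cone_def by auto

text \<open>The sum is the midpoint of \<open>2 *\<^sub>R x\<close> and
  \<open>2 *\<^sub>R y\<close>, and doubling \<open>x\<close> keeps it in the core, so the result on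
  convex combinations applies.\<close>

lemma cor_convex_cone_add:
  assumes "convex_cone K" "x \<in> cor K" "y \<in> K"
  shows "x + y \<in> cor K"
proof -
  have "convex K"
    using assms(1) by (simp add: convex_cone_def)
  moreover have "2 *\<^sub>R y \<in> K"
    using assms by - (rule convex_cone_scaleR, auto)
  moreover have "2 *\<^sub>R x \<in> cor K"
  proof -
    have "\<exists>\<epsilon>>0. \<forall>t\<in>{0..\<epsilon>}. 2 *\<^sub>R x + t *\<^sub>R v \<in> K" for v
    proof -
      obtain \<epsilon> where \<epsilon>: "\<epsilon> > 0" "\<forall>t\<in>{0..\<epsilon>}. x + t *\<^sub>R v \<in> K"
        using assms(2) unfolding cor_def by blast
      have "x + (x + t *\<^sub>R v) \<in> K" if "t \<in> {0..\<epsilon>}" for t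
        using \<epsilon>(2) that assms(2) cor_subset by - (rule convex_cone_add[OF assms(1)], blast+)
      with \<epsilon>(1) show ?thesis
        by (auto simp: scaleR_2 add.assoc)
    qed
    moreover have "2 *\<^sub>R x \<in> K"
      using assms cor_subset by - (rule convex_cone_scaleR, auto)
    ultimately show ?thesis
      unfolding cor_def by blast
  qed
  ultimately have "(1/2) *\<^sub>R (2 *\<^sub>R x) + (1/2) *\<^sub>R (2 *\<^sub>R y) \<in> cor K"
    by (intro cor_convex_combination) auto
  then show ?thesis
    by simp
qed

lemma cor_convex_cone_scaleR:
  assumes "convex_cone K" "x \<in> cor K" "0 < c"
  shows "c *\<^sub>R x \<in> cor K"
proof -
  have "\<exists>\<epsilon>>0. \<forall>t\<in>{0..\<epsilon>}. c *\<^sub>R x + t *\<^sub>R v \<in> K" for v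
  proof -
    obtain \<epsilon> where \<epsilon>: "\<epsilon> > 0" "\<forall>t\<in>{0..\<epsilon>}. x + t *\<^sub>R ((1 / c) *\<^sub>R v) \<in> K"
      using assms(2) unfolding cor_def by blast
    have "c *\<^sub>R x + t *\<^sub>R v \<in> K" if "t \<in> {0..\<epsilon>}" for t
    proof -
      have "c *\<^sub>R (x + t *\<^sub>R ((1 / c) *\<^sub>R v)) \<in> K"
        using that \<epsilon> assms by - (rule convex_cone_scaleR, auto)
      then show ?thesis
        using assms(3) by (simp add: algebra_simps)
    qed
    with \<epsilon>(1) show ?thesis
      by blast
  qed
  moreover have "c *\<^sub>R x \<in> K"
    using assms cor_subset by - (rule convex_cone_scaleR, auto)
  ultimately show ?thesis
    unfolding cor_def by blast
qed

text \<open>A short step from 0 in any direction rescales to the whole ray, so a cone with 0 in its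
  core is the whole space.\<close>

lemma zero_notin_cor_nontrivial_cone:
  assumes "nontrivial_cone K"
  shows "0 \<notin> cor K"
proof
  assume "0 \<in> cor K"
  have "v \<in> K" for v
  proof -
    obtain \<epsilon> where "\<epsilon> > 0" "\<epsilon> *\<^sub>R v \<in> K"
      using corD[OF \<open>0 \<in> cor K\<close>, of v] by auto
    then have "inverse \<epsilon> *\<^sub>R \<epsilon> *\<^sub>R v \<in> K"
      using assms unfolding nontrivial_cone_def cone0_def
      by (metis inverse_nonnegative_iff_nonnegative less_imp_le mem_cone)
    with \<open>\<epsilon> > 0\<close> show ?thesis
      by simp
  qed
  then show False
    using assms unfolding nontrivial_cone_def by blast
qed

text \<open>For \<open>e\<close> in the core, every direction is up to a positive factor the
  difference of a point of \<open>K\<close> and \<open>e\<close>. Hence the affine hull in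
  \<open>icor\<close> is the whole space.\<close>

lemma icor_eq_cor_if_solid:
  fixes K :: "'a::real_vector set"
  assumes "solid K"
  shows "icor K = cor K"
proof -
  obtain e where e: "e \<in> cor K"
    using assms unfolding solid_def by blast
  define D where "D = {y - z | y z. y \<in> K \<and> z \<in> K}"
  have "e \<in> K"
    using e cor_subset by blast
  then have "0 \<in> affine hull D"
    unfolding D_def by (intro hull_inc) force
  then have sub: "subspace (affine hull D)"
    by (simp add: subspace_affine)
  have "v \<in> affine hull D" for v
  proof -
    obtain \<epsilon> where \<epsilon>: "\<epsilon> > 0" "e + \<epsilon> *\<^sub>R v \<in> K"
      using corD[OF e] by blast
    then have "(e + \<epsilon> *\<^sub>R v) - e \<in> D"
      unfolding D_def using \<open>e \<in> K\<close> by blast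
    then have "\<epsilon> *\<^sub>R v \<in> affine hull D"
      by (simp add: hull_inc)
    then have "inverse \<epsilon> *\<^sub>R \<epsilon> *\<^sub>R v \<in> affine hull D"
      using sub by (rule subspace_scale[rotated])
    with \<epsilon>(1) show ?thesis
      by simp
  qed
  then have "affine hull D = UNIV"
    by blast
  then show ?thesis
    unfolding icor_def cor_def D_def by simp
qed

section \<open>Positive functionals and the separation of two convex cones\<close>

text \<open>From \<open>x\<close> one can move within \<open>K\<close> in a direction in which
  \<open>f\<close> strictly decreases, and the value is still nonnegative after the move.\<close>

lemma pos_on_cor:
  fixes f :: "'a::real_vector \<Rightarrow> real"
  assumes "linear f" "f \<noteq> (\<lambda>_. 0)" "\<And>k. k \<in> K \<Longrightarrow> 0 \<le> f k" "x \<in> cor K"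
  shows "0 < f x"
proof -
  obtain v where "f v \<noteq> 0"
    using assms(2) by blast
  define w where "w = (if f v < 0 then v else - v)"
  have "f w < 0"
    using \<open>f v \<noteq> 0\<close> linear_neg[OF assms(1)] by (auto simp: w_def)
  obtain \<epsilon> where "\<epsilon> > 0" "x + \<epsilon> *\<^sub>R w \<in> K"
    using corD[OF assms(4)] by blast
  then have "0 \<le> f x + \<epsilon> * f w"
    using assms(1,3) by (metis linear_add linear_scale real_scaleR_def)
  moreover have "\<epsilon> * f w < 0"
    using \<open>\<epsilon> > 0\<close> \<open>f w < 0\<close> by (simp add: mult_pos_neg)
  ultimately show ?thesis
    by linarith
qed

text \<open>An equation \<open>- e = a + k\<close> would give \<open>a = - (e + k)\<close>, a point
  of the core of \<open>- K\<close>, since adding \<open>k\<close> keeps \<open>e\<close> in the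
  core. So \<open>A + K\<close> avoids \<open>- e\<close> and extends to a total cone.\<close>

lemma separation_convex_cones:
  fixes K A :: "'a::real_vector set"
  assumes K: "convex_cone K" "solid K" and A: "convex_cone A"
    and disj: "A \<inter> cor (uminus ` K) = {}"
  obtains f where "f \<in> dual_cone K" "f \<noteq> (\<lambda>_. 0)" "\<And>a. a \<in> A \<Longrightarrow> 0 \<le> f a"
proof -
  obtain e where e: "e \<in> cor K"
    using K(2) unfolding solid_def by blast
  define D where "D = (\<Union>a\<in>A. \<Union>k\<in>K. {a + k})"
  have D: "convex_cone D"
    unfolding D_def using K A by (intro convex_cone_sums)
  have "- e \<notin> D"
  proof
    assume "- e \<in> D"
    then obtain a k where ak: "a \<in> A" "k \<in> K" "- e = a + k"
      unfolding D_def by blast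
    then have "a = - (e + k)"
      by (simp add: algebra_simps)
    moreover have "e + k \<in> cor K"
      using K(1) e ak(2) by (rule cor_convex_cone_add)
    ultimately show False
      using ak(1) disj unfolding cor_uminus by blast
  qed
  then obtain C where C: "D \<subseteq> C" "convex_cone C" "- e \<notin> C" "\<And>x. x \<in> C \<or> - x \<in> C"
    using maximal_convex_cone_total[OF D] by blast
  have "K \<subseteq> D"
    unfolding D_def using convex_cone_contains_0[OF A]
    by (intro subsetI UN_I[of 0] UN_I) auto
  have "A \<subseteq> D"
    unfolding D_def using convex_cone_contains_0[OF K(1)]
    by (intro subsetI UN_I[of _ A] UN_I[of 0 K]) auto
  have "\<exists>t. x + t *\<^sub>R e \<in> C" for x
  proof -
    obtain \<epsilon> where \<epsilon>: "\<epsilon> > 0" "e + \<epsilon> *\<^sub>R x \<in> K"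
      using corD[OF e] by blast
    then have "inverse \<epsilon> *\<^sub>R (e + \<epsilon> *\<^sub>R x) \<in> K"
      using K(1) by - (rule convex_cone_scaleR, auto)
    with \<epsilon> have "x + inverse \<epsilon> *\<^sub>R e \<in> K"
      by (simp add: algebra_simps)
    then show ?thesis
      using \<open>K \<subseteq> D\<close> C(1) by blast
  qed
  \<comment> \<open>The normalisation \<open>f e = 1\<close> is what makes \<open>f\<close>
    nonzero.\<close>
  with C obtain f :: "'a \<Rightarrow> real" where "linear f" "f e = 1" "\<And>x. x \<in> C \<Longrightarrow> 0 \<le> f x"
    using order_unit_functional[of C e] by metis
  then show ?thesis
    using \<open>K \<subseteq> D\<close> \<open>A \<subseteq> D\<close> C(1) that[of f] unfolding dual_cone_def by force
qed

section \<open>Normlike bases\<close>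

lemma normlike_base_scale:
  assumes "seminorm \<psi>" "nontrivial_cone K" "has_normlike_base \<psi> K" "x \<in> K" "x \<noteq> 0"
  obtains b where "b \<in> normlike_base \<psi> K" "x = \<psi> x *\<^sub>R b" "0 < \<psi> x"
proof -
  have pos: "0 < \<psi> x"
    using assms unfolding has_normlike_base_def by blast
  have "inverse (\<psi> x) *\<^sub>R x \<in> K"
    using assms pos unfolding nontrivial_cone_def cone0_def cone_def by auto
  moreover have "\<psi> (inverse (\<psi> x) *\<^sub>R x) = 1"
    using assms(1) pos unfolding seminorm_def by simp
  ultimately show ?thesis
    using pos that[of "inverse (\<psi> x) *\<^sub>R x"] unfolding normlike_base_def by simp
qed

lemma S_zero_subset:
  assumes "nontrivial_cone A" "convex A"
  shows "S_zero \<psi> A \<subseteq> A"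
  using assms unfolding S_zero_def normlike_base_def nontrivial_cone_def cone0_def
  by (intro hull_minimal) auto

lemma S_minus_subset:
  assumes "convex K"
  shows "S_minus \<psi> K \<subseteq> uminus ` K"
  using assms unfolding S_minus_def normlike_base_def
  by (intro hull_minimal) (auto intro: convex_negations)

text \<open>The unit ball of a seminorm is convex, and by symmetry it contains the negated
  base.\<close>

lemma S_minus_le_1:
  assumes "seminorm \<psi>" "x \<in> S_minus \<psi> K"
  shows "\<psi> x \<le> 1"
proof -
  have "\<psi> (u *\<^sub>R x + v *\<^sub>R y) \<le> 1"
    if "\<psi> x \<le> 1" "\<psi> y \<le> 1" "0 \<le> u" "0 \<le> v" "u + v = 1" for x y u v
  proof -
    have "\<psi> (u *\<^sub>R x + v *\<^sub>R y) \<le> u * \<psi> x + v * \<psi> y"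
      using assms(1) that unfolding seminorm_def by metis
    also have "\<dots> \<le> 1"
      using that by (intro convex_bound_le)
    finally show ?thesis .
  qed
  then have "convex {x. \<psi> x \<le> 1}"
    by (simp add: convex_def)
  then have "S_minus \<psi> K \<subseteq> {x. \<psi> x \<le> 1}"
    using assms(1) unfolding S_minus_def normlike_base_def seminorm_def
    by (intro hull_minimal) auto
  with assms(2) show ?thesis
    by blast
qed

text \<open>Contrapositive form of the implication from the first assertion to the second.\<close>

lemma S_zero_meets_cor_S_minus:
  fixes K A :: "'a::real_vector set"
  assumes \<psi>: "seminorm \<psi>"
    and K: "nontrivial_cone K" "convex K" "has_normlike_base \<psi> K"
    and A: "nontrivial_cone A" "convex A" "has_normlike_base \<psi> A"
    and S: "solid (S_minus \<psi> K)"
    and a: "a \<in> A" "a \<in> cor (uminus ` K)"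
  shows "S_zero \<psi> A \<inter> cor (S_minus \<psi> K) \<noteq> {}"
proof -
  have "a \<noteq> 0"
    using a(2) zero_notin_cor_nontrivial_cone[OF K(1)] by (auto simp: cor_uminus)
  with \<psi> A(1,3) a(1) obtain b
    where b: "b \<in> normlike_base \<psi> A" "a = \<psi> a *\<^sub>R b" "0 < \<psi> a"
    by (rule normlike_base_scale)
  have Kc: "convex_cone (uminus ` K)"
    using convex_cone_nontrivial_cone[OF K(1,2)]
    by (simp add: convex_cone_linear_image linear_uminus)
  have "inverse (\<psi> a) *\<^sub>R a \<in> cor (uminus ` K)"
    using Kc a(2) b(3) by (intro cor_convex_cone_scaleR) auto
  moreover have "inverse (\<psi> a) *\<^sub>R a = b"
    using b(2,3) by (metis inverse_inverse_eq less_numeral_extra(3) scaleR_one scaleR_scaleR left_inverse)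
  ultimately have "b \<in> cor (uminus ` K)"
    by simp
  obtain s where s: "s \<in> cor (S_minus \<psi> K)"
    using S unfolding solid_def by blast
  \<comment> \<open>A small multiple of \<open>s\<close> is split off from \<open>b\<close>; the
    remainder stays in \<open>- K\<close> and is next written as a multiple of a point of
    \<open>S_minus \<psi> K\<close>.\<close>
  obtain \<epsilon> where \<epsilon>: "\<epsilon> > 0" "b + \<epsilon> *\<^sub>R (- s) \<in> uminus ` K"
    using corD[OF \<open>b \<in> cor (uminus ` K)\<close>] by blast
  then obtain k where k: "k \<in> K" "b + \<epsilon> *\<^sub>R (- s) = - k"
    by blast
  have "\<exists>\<mu> d. 0 \<le> \<mu> \<and> d \<in> S_minus \<psi> K \<and> - k = \<mu> *\<^sub>R d"
  \<comment> \<open>Zero cannot be normalised, so it gets the coefficient 0 and \<open>s\<close> as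
    an arbitrary point of the hull.\<close>
  proof (cases "k = 0")
    case True
    then show ?thesis
      using s cor_subset by (intro exI[of _ 0] exI[of _ s]) auto
  next
    case False
    with \<psi> K(1,3) k(1) obtain d
      where d: "d \<in> normlike_base \<psi> K" "k = \<psi> k *\<^sub>R d" "0 < \<psi> k"
      by (rule normlike_base_scale)
    have "- d \<in> S_minus \<psi> K"
      unfolding S_minus_def using d(1) by (intro hull_inc) auto
    then show ?thesis
      using d by (intro exI[of _ "\<psi> k"] exI[of _ "- d"]) auto
  qed
  then obtain \<mu> d where \<mu>: "0 \<le> \<mu>" "d \<in> S_minus \<psi> K" "- k = \<mu> *\<^sub>R d"
    by blast
  have b_eq: "b = \<epsilon> *\<^sub>R s + \<mu> *\<^sub>R d"
    using k(2) \<mu>(3) by (simp add: algebra_simps)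
  \<comment> \<open>The bound on \<open>\<epsilon> + \<mu>\<close> ensures that normalising the two
    weights to sum 1 shrinks \<open>b\<close> and does not stretch it.\<close>
  have "1 = \<psi> b"
    using b(1) unfolding normlike_base_def by simp
  also have "\<dots> \<le> \<epsilon> * \<psi> s + \<mu> * \<psi> d"
    unfolding b_eq using \<psi> \<epsilon>(1) \<mu>(1) unfolding seminorm_def by (metis less_imp_le)
  also have "\<dots> \<le> \<epsilon> * 1 + \<mu> * 1"
    using \<epsilon>(1) \<mu>(1,2) s cor_subset S_minus_le_1[OF \<psi>]
    by (intro add_mono mult_left_mono) auto
  finally have ge: "1 \<le> \<epsilon> + \<mu>"
    by simp
  define r where "r = inverse (\<epsilon> + \<mu>)"
  have r: "0 < r" "r \<le> 1" "r * (\<epsilon> + \<mu>) = 1"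
    using ge \<epsilon>(1) unfolding r_def by (auto simp: field_simps)
  have "(r * \<epsilon>) *\<^sub>R s + (r * \<mu>) *\<^sub>R d \<in> cor (S_minus \<psi> K)"
    using s \<mu> \<epsilon>(1) r
    by (intro cor_convex_combination) (auto simp: S_minus_def distrib_left)
  then have "r *\<^sub>R b \<in> cor (S_minus \<psi> K)"
    by (simp add: b_eq scaleR_add_right)
  \<comment> \<open>As \<open>r \<le> 1\<close>, the point lies on the segment from 0 to
    \<open>b\<close>; this is where the 0 adjoined to the base of \<open>A\<close> enters.\<close>
  moreover have "r *\<^sub>R b + (1 - r) *\<^sub>R 0 \<in> S_zero \<psi> A"
    unfolding S_zero_def using r b(1)
    by (intro convexD[OF convex_convex_hull] hull_inc) auto
  ultimately show ?thesis
    by auto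
qed

section \<open>Equivalence of the four disjointness and separation conditions\<close>

theorem theorem5p5:
  fixes \<psi> :: "'a::real_vector \<Rightarrow> real"
    and K A :: "'a set"
  assumes "(UNIV :: 'a set) \<noteq> {0}"
    and "seminorm \<psi>"
    and "nontrivial_cone K" and "convex K" and "has_normlike_base \<psi> K"
    and "nontrivial_cone A" and "convex A" and "has_normlike_base \<psi> A"
    and "solid K"
    and "solid (S_minus \<psi> K)"
  shows
    "(S_zero \<psi> A \<inter> cor (S_minus \<psi> K) = {} \<longleftrightarrow> A \<inter> cor (uminus ` K) = {}) \<and>
     (A \<inter> cor (uminus ` K) = {} \<longleftrightarrow>
        (\<exists>x' \<in> dual_cone K - {\<lambda>_. 0}.
           \<forall>a \<in> A. \<forall>k \<in> cor (uminus ` K). x' a \<ge> 0 \<and> 0 > x' k)) \<and>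
     ((\<exists>x' \<in> dual_cone K - {\<lambda>_. 0}.
           \<forall>a \<in> A. \<forall>k \<in> cor (uminus ` K). x' a \<ge> 0 \<and> 0 > x' k) \<longleftrightarrow>
        (\<exists>(x', \<alpha>) \<in> aug_dual_cone \<psi> K.
           \<forall>a \<in> A. \<forall>k \<in> cor (uminus ` K).
             x' a + \<alpha> * \<psi> a \<ge> 0 \<and> 0 > x' k + \<alpha> * \<psi> k))"
    (is "(?A1 \<longleftrightarrow> ?A2) \<and> (?A2 \<longleftrightarrow> ?A3) \<and> (?A3 \<longleftrightarrow> ?A4)")
proof -
  have K: "convex_cone K" and A: "convex_cone A"
    using assms by (auto intro: convex_cone_nontrivial_cone)
  \<comment> \<open>Both sets in the first assertion are contained in the corresponding sets of the
    second.\<close>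
  have "?A1" if "?A2"
    using that S_zero_subset[OF assms(6,7)] cor_mono[OF S_minus_subset[OF assms(4)]] by blast
  moreover have "?A2" if "?A1"
    using that S_zero_meets_cor_S_minus[OF assms(2-8,10)] by blast
  moreover have "?A3 \<and> ?A4" if "?A2"
  proof -
    obtain f where f: "f \<in> dual_cone K" "f \<noteq> (\<lambda>_. 0)" "\<And>a. a \<in> A \<Longrightarrow> 0 \<le> f a"
      using separation_convex_cones[OF K assms(9) A \<open>?A2\<close>] by blast
    have lin: "linear f"
      using f(1) unfolding dual_cone_def by blast
    have pos: "0 < f x" if "x \<in> cor K" for x
      using lin f(1,2) that unfolding dual_cone_def by (intro pos_on_cor[of f K]) auto
    then have neg: "f k < 0" if "k \<in> cor (uminus ` K)" for k
      using that linear_neg[OF lin] by (auto simp: cor_uminus)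
    obtain e where e: "e \<in> cor K"
      using assms(9) unfolding solid_def by blast
    have "f \<notin> lineality (dual_cone K)"
    proof
      assume "f \<in> lineality (dual_cone K)"
      then have "0 \<le> - f e"
        using e cor_subset unfolding lineality_def dual_cone_def by fastforce
      with pos[OF e] show False
        by simp
    qed
    \<comment> \<open>With second component 0 the condition on \<open>icor K\<close> is just
      positivity of \<open>f\<close> on the core, as \<open>K\<close> is solid.\<close>
    then have "(f, 0) \<in> aug_dual_cone \<psi> K"
      using f(1) pos unfolding aug_dual_cone_def by (simp add: icor_eq_cor_if_solid[OF assms(9)])
    moreover have "\<forall>a\<in>A. \<forall>k\<in>cor (uminus ` K). 0 \<le> f a \<and> f k < 0"
      using f(3) neg by blast
    ultimately have "?A3" "?A4"
      using f(1,2) by (auto intro!: bexI[of _ f] bexI[of _ "(f, 0)"])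
    then show ?thesis ..
  qed
  \<comment> \<open>At a common point, taken as both \<open>a\<close> and \<open>k\<close>, the same
    number would be nonnegative and negative; this also settles the fourth assertion.\<close>
  moreover have "?A2" if "?A3"
    using that by fastforce
  moreover have "?A2" if "?A4"
    using that by fastforce
  ultimately show ?thesis
    by blast
qed

end
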